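(* Let $(M,\varphi,\xi,\eta,g)$ be a 3-dimensional almost contact B-metric manifold. Then there exists no $\varphi$-slant null curve $C$ in $M$ whose constants $a=\eta(\dot C)$ and $b=g(\dot C,\varphi\dot C)$ satisfy $a=b=0$.
   Context: A 3-dimensional almost contact B-metric manifold $(M,\varphi,\xi,\eta,g)$ is a smooth 3-manifold with a $(1,1)$-tensor field $\varphi$, a vector field $\xi$, a 1-form $\eta$ and a semi-Riemannian metric $g$ such that $\varphi^2X=-X+\eta(X)\xi$, $\eta(\xi)=1$, and $g(\varphi X,\varphi Y)=-g(X,Y)+\eta(X)\eta(Y)$ for all vector fields $X,Y$. Consequently $\eta\circ\varphi=0$, $\varphi\xi=0$, $\eta(X)=g(X,\xi)$, $g(\xi,\xi)=1$, the metric $g$ has signature $(2,1)$ (Lorentzian), and its restriction to the contact distribution $\ker\eta$ has signature $(1,1)$. A smooth curve $C:I\to M$ ($I\subseteq\mathbb{R}$ an interval) with tangent vector $\dot C$ is null if $g(\dot C,\dot C)=0$ and $\dot C\neq 0$ everywhere. It is $\varphi$-slant if $\eta(\dot C(t))=g(\dot C(t),\xi)=a$ and $g(\dot C(t),\varphi\dot C(t))=b$ for all $t$, where $a,b$ are real constants. *)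

theory Defs
  imports "HOL-Analysis.Analysis"
begin

text \<open>
  Derivatives are taken within \<open>S\<close>. The definition is only used for \<open>S\<close> open, where these are the
  ordinary derivatives, and for \<open>S\<close> a relatively open subset of a nondegenerate real interval, where
  they are one-sided at an endpoint. In both cases the derivative within \<open>S\<close> is unique.
\<close>

primrec Ck_on :: "nat \<Rightarrow> 'a::euclidean_space set \<Rightarrow> ('a \<Rightarrow> 'b::real_normed_vector) \<Rightarrow> bool" where
  "Ck_on 0 S f \<longleftrightarrow> continuous_on S f"
| "Ck_on (Suc k) S f \<longleftrightarrow> f differentiable_on S \<and>
     (\<forall>v. Ck_on k S (\<lambda>x. frechet_derivative f (at x within S) v))"

definition smooth_on :: "'a::euclidean_space set \<Rightarrow> ('a \<Rightarrow> 'b::real_normed_vector) \<Rightarrow> bool" where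
  "smooth_on S f \<longleftrightarrow> (\<forall>k. Ck_on k S f)"

text \<open>
  A chart is a pair of its domain and its coordinate map; the values of the map outside the domain
  are irrelevant. A smooth structure is given by an arbitrary, not necessarily maximal, atlas.
\<close>

type_synonym ('a, 'e) chart = "'a set \<times> ('a \<Rightarrow> 'e)"

definition chart_inv :: "('a, 'e) chart \<Rightarrow> 'e \<Rightarrow> 'a" where
  "chart_inv c = inv_into (fst c) (snd c)"

definition is_chart :: "'a topology \<Rightarrow> ('a, 'e::euclidean_space) chart \<Rightarrow> bool" where
  "is_chart X c \<longleftrightarrow> openin X (fst c) \<and> open (snd c ` fst c) \<and>
     homeomorphic_map (subtopology X (fst c)) (top_of_set (snd c ` fst c)) (snd c)"

definition smooth_manifold :: "'a topology \<Rightarrow> ('a, 'e::euclidean_space) chart set \<Rightarrow> bool" where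
  "smooth_manifold X A \<longleftrightarrow>
     Hausdorff_space X \<and> second_countable X \<and>
     (\<forall>c\<in>A. is_chart X c) \<and> (\<Union>c\<in>A. fst c) = topspace X \<and>
     (\<forall>c\<in>A. \<forall>d\<in>A. smooth_on (snd c ` (fst c \<inter> fst d)) (snd d \<circ> chart_inv c))"

text \<open>
  A tangent vector at \<open>p\<close> is the family of its coordinate representations in the charts around \<open>p\<close>,
  related by the derivatives of the transition maps. Setting the family to 0 on all other arguments
  makes it determined by the vector; the vector space operations are the pointwise ones.
\<close>

type_synonym ('a, 'e) tvec = "('a, 'e) chart \<Rightarrow> 'e"

definition charts_at :: "('a, 'e) chart set \<Rightarrow> 'a \<Rightarrow> ('a, 'e) chart set" where
  "charts_at A p = {c \<in> A. p \<in> fst c}"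

definition transition_deriv ::
  "('a, 'e::euclidean_space) chart \<Rightarrow> ('a, 'e) chart \<Rightarrow> 'a \<Rightarrow> 'e \<Rightarrow> 'e" where
  "transition_deriv c d p = frechet_derivative (snd d \<circ> chart_inv c) (at (snd c p))"

definition tangent_space ::
  "('a, 'e::euclidean_space) chart set \<Rightarrow> 'a \<Rightarrow> ('a, 'e) tvec set" where
  "tangent_space A p = {v.
     (\<forall>c\<in>charts_at A p. \<forall>d\<in>charts_at A p. v d = transition_deriv c d p (v c)) \<and>
     (\<forall>c. c \<notin> charts_at A p \<longrightarrow> v c = 0)}"

definition tzero :: "('a, 'e::euclidean_space) tvec" where
  "tzero = (\<lambda>c. 0)"

definition tadd :: "('a, 'e::euclidean_space) tvec \<Rightarrow> ('a, 'e) tvec \<Rightarrow> ('a, 'e) tvec" where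
  "tadd u v = (\<lambda>c. u c + v c)"

definition tscale :: "real \<Rightarrow> ('a, 'e::euclidean_space) tvec \<Rightarrow> ('a, 'e) tvec" where
  "tscale r v = (\<lambda>c. r *\<^sub>R v c)"

text \<open>The tangent vector at \<open>p\<close> whose coordinate representation in the chart \<open>c\<close> around \<open>p\<close> is \<open>e\<close>.\<close>

definition coord_tvec ::
  "('a, 'e::euclidean_space) chart set \<Rightarrow> ('a, 'e) chart \<Rightarrow> 'a \<Rightarrow> 'e \<Rightarrow> ('a, 'e) tvec" where
  "coord_tvec A c p e = (\<lambda>d. if d \<in> charts_at A p then transition_deriv c d p e else 0)"

text \<open>
  Tensor fields are given by multilinear maps on each tangent space; they are smooth if their
  components in every chart are smooth functions of the coordinates.
\<close>

definition vector_field ::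
  "'a topology \<Rightarrow> ('a, 'e::euclidean_space) chart set \<Rightarrow> ('a \<Rightarrow> ('a, 'e) tvec) \<Rightarrow> bool" where
  "vector_field X A V \<longleftrightarrow>
     (\<forall>p\<in>topspace X. V p \<in> tangent_space A p) \<and>
     (\<forall>c\<in>A. smooth_on (snd c ` fst c) (\<lambda>x. V (chart_inv c x) c))"

definition one_form ::
  "'a topology \<Rightarrow> ('a, 'e::euclidean_space) chart set \<Rightarrow> ('a \<Rightarrow> ('a, 'e) tvec \<Rightarrow> real) \<Rightarrow> bool" where
  "one_form X A \<omega> \<longleftrightarrow>
     (\<forall>p\<in>topspace X. \<forall>u\<in>tangent_space A p. \<forall>v\<in>tangent_space A p. \<forall>r.
        \<omega> p (tadd u v) = \<omega> p u + \<omega> p v \<and> \<omega> p (tscale r u) = r * \<omega> p u) \<and>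
     (\<forall>c\<in>A. \<forall>e. smooth_on (snd c ` fst c)
        (\<lambda>x. \<omega> (chart_inv c x) (coord_tvec A c (chart_inv c x) e)))"

definition tensor_field_11 ::
  "'a topology \<Rightarrow> ('a, 'e::euclidean_space) chart set \<Rightarrow>
     ('a \<Rightarrow> ('a, 'e) tvec \<Rightarrow> ('a, 'e) tvec) \<Rightarrow> bool" where
  "tensor_field_11 X A F \<longleftrightarrow>
     (\<forall>p\<in>topspace X. \<forall>u\<in>tangent_space A p. F p u \<in> tangent_space A p) \<and>
     (\<forall>p\<in>topspace X. \<forall>u\<in>tangent_space A p. \<forall>v\<in>tangent_space A p. \<forall>r.
        F p (tadd u v) = tadd (F p u) (F p v) \<and> F p (tscale r u) = tscale r (F p u)) \<and>
     (\<forall>c\<in>A. \<forall>e. smooth_on (snd c ` fst c)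
        (\<lambda>x. F (chart_inv c x) (coord_tvec A c (chart_inv c x) e) c))"

definition tensor_field_02 ::
  "'a topology \<Rightarrow> ('a, 'e::euclidean_space) chart set \<Rightarrow>
     ('a \<Rightarrow> ('a, 'e) tvec \<Rightarrow> ('a, 'e) tvec \<Rightarrow> real) \<Rightarrow> bool" where
  "tensor_field_02 X A g \<longleftrightarrow>
     (\<forall>p\<in>topspace X. \<forall>u\<in>tangent_space A p. \<forall>v\<in>tangent_space A p. \<forall>w\<in>tangent_space A p. \<forall>r.
        g p (tadd u v) w = g p u w + g p v w \<and> g p (tscale r u) w = r * g p u w \<and>
        g p w (tadd u v) = g p w u + g p w v \<and> g p w (tscale r u) = r * g p w u) \<and>
     (\<forall>c\<in>A. \<forall>e f. smooth_on (snd c ` fst c)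
        (\<lambda>x. g (chart_inv c x) (coord_tvec A c (chart_inv c x) e)
                               (coord_tvec A c (chart_inv c x) f)))"

text \<open>
  The index of \<open>g\<close> at \<open>p\<close>: the largest dimension of a subspace of the tangent space on which \<open>g\<close> is
  negative definite. Subspaces of the tangent space are described by their coordinates in a chart
  \<open>c\<close> around \<open>p\<close>; the value does not depend on \<open>c\<close>.
\<close>

definition metric_index ::
  "('a, 'e::euclidean_space) chart set \<Rightarrow> ('a \<Rightarrow> ('a, 'e) tvec \<Rightarrow> ('a, 'e) tvec \<Rightarrow> real) \<Rightarrow>
     ('a, 'e) chart \<Rightarrow> 'a \<Rightarrow> nat" where
  "metric_index A g c p = Max {dim W | W. subspace W \<and>
     (\<forall>e\<in>W. e \<noteq> 0 \<longrightarrow> g p (coord_tvec A c p e) (coord_tvec A c p e) < 0)}"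

definition semi_riemannian_metric ::
  "'a topology \<Rightarrow> ('a, 'e::euclidean_space) chart set \<Rightarrow>
     ('a \<Rightarrow> ('a, 'e) tvec \<Rightarrow> ('a, 'e) tvec \<Rightarrow> real) \<Rightarrow> bool" where
  "semi_riemannian_metric X A g \<longleftrightarrow> tensor_field_02 X A g \<and>
     (\<forall>p\<in>topspace X. \<forall>u\<in>tangent_space A p. \<forall>v\<in>tangent_space A p. g p u v = g p v u) \<and>
     (\<forall>p\<in>topspace X. \<forall>u\<in>tangent_space A p.
        (\<forall>v\<in>tangent_space A p. g p u v = 0) \<longrightarrow> u = tzero) \<and>
     (\<exists>\<nu>. \<forall>p\<in>topspace X. \<forall>c\<in>charts_at A p. metric_index A g c p = \<nu>)"

text \<open>
  The structure identities are equations between tensor fields, hence stated for all tangent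
  vectors at all points.
\<close>

definition almost_contact_B_metric_3manifold ::
  "'a topology \<Rightarrow> ('a, real ^ 3) chart set \<Rightarrow>
     ('a \<Rightarrow> ('a, real ^ 3) tvec \<Rightarrow> ('a, real ^ 3) tvec) \<Rightarrow>
     ('a \<Rightarrow> ('a, real ^ 3) tvec) \<Rightarrow>
     ('a \<Rightarrow> ('a, real ^ 3) tvec \<Rightarrow> real) \<Rightarrow>
     ('a \<Rightarrow> ('a, real ^ 3) tvec \<Rightarrow> ('a, real ^ 3) tvec \<Rightarrow> real) \<Rightarrow> bool" where
  "almost_contact_B_metric_3manifold X A \<phi> \<xi> \<eta> g \<longleftrightarrow>
     smooth_manifold X A \<and> tensor_field_11 X A \<phi> \<and> vector_field X A \<xi> \<and>
     one_form X A \<eta> \<and> semi_riemannian_metric X A g \<and>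
     (\<forall>p\<in>topspace X. \<forall>u\<in>tangent_space A p.
        \<phi> p (\<phi> p u) = tadd (tscale (- 1) u) (tscale (\<eta> p u) (\<xi> p))) \<and>
     (\<forall>p\<in>topspace X. \<eta> p (\<xi> p) = 1) \<and>
     (\<forall>p\<in>topspace X. \<forall>u\<in>tangent_space A p. \<forall>v\<in>tangent_space A p.
        g p (\<phi> p u) (\<phi> p v) = - g p u v + \<eta> p u * \<eta> p v)"

definition smooth_curve ::
  "'a topology \<Rightarrow> ('a, 'e::euclidean_space) chart set \<Rightarrow> real set \<Rightarrow> (real \<Rightarrow> 'a) \<Rightarrow> bool" where
  "smooth_curve X A I C \<longleftrightarrow>
     is_interval I \<and> (\<exists>s\<in>I. \<exists>t\<in>I. s < t) \<and>
     continuous_map (top_of_set I) X C \<and>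
     (\<forall>c\<in>A. smooth_on {t \<in> I. C t \<in> fst c} (snd c \<circ> C))"

definition velocity ::
  "('a, 'e::euclidean_space) chart set \<Rightarrow> real set \<Rightarrow> (real \<Rightarrow> 'a) \<Rightarrow> real \<Rightarrow> ('a, 'e) tvec" where
  "velocity A I C t = (\<lambda>c. if c \<in> charts_at A (C t)
     then vector_derivative (snd c \<circ> C) (at t within I) else 0)"

definition null_curve ::
  "'a topology \<Rightarrow> ('a, 'e::euclidean_space) chart set \<Rightarrow>
     ('a \<Rightarrow> ('a, 'e) tvec \<Rightarrow> ('a, 'e) tvec \<Rightarrow> real) \<Rightarrow> real set \<Rightarrow> (real \<Rightarrow> 'a) \<Rightarrow> bool" where
  "null_curve X A g I C \<longleftrightarrow> smooth_curve X A I C \<and>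
     (\<forall>t\<in>I. g (C t) (velocity A I C t) (velocity A I C t) = 0 \<and> velocity A I C t \<noteq> tzero)"

definition phi_slant ::
  "('a, 'e::euclidean_space) chart set \<Rightarrow>
     ('a \<Rightarrow> ('a, 'e) tvec \<Rightarrow> ('a, 'e) tvec) \<Rightarrow> ('a \<Rightarrow> ('a, 'e) tvec) \<Rightarrow>
     ('a \<Rightarrow> ('a, 'e) tvec \<Rightarrow> real) \<Rightarrow> ('a \<Rightarrow> ('a, 'e) tvec \<Rightarrow> ('a, 'e) tvec \<Rightarrow> real) \<Rightarrow>
     real set \<Rightarrow> (real \<Rightarrow> 'a) \<Rightarrow> real \<Rightarrow> real \<Rightarrow> bool" where
  "phi_slant A \<phi> \<xi> \<eta> g I C a b \<longleftrightarrow> (\<forall>t\<in>I.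
     \<eta> (C t) (velocity A I C t) = a \<and>
     g (C t) (velocity A I C t) (\<xi> (C t)) = a \<and>
     g (C t) (velocity A I C t) (\<phi> (C t) (velocity A I C t)) = b)"

end

theory Submission
  imports Defs
begin

text \<open>
  If \<open>a = b = 0\<close>, the velocity \<open>u\<close> is orthogonal to \<open>u\<close>, \<open>\<phi> u\<close> and \<open>\<xi>\<close>. From \<open>\<eta> u = 0\<close> one gets
  \<open>\<eta> (\<phi> u) = 0\<close>, so \<open>\<phi>\<close> acts as a complex structure on the plane through \<open>u\<close> and \<open>\<phi> u\<close>, which lies in
  the kernel of \<open>\<eta>\<close>. Hence \<open>u\<close>, \<open>\<phi> u\<close>, \<open>\<xi>\<close> form a basis of the tangent space, and \<open>u = 0\<close> by
  nondegeneracy of \<open>g\<close>.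
\<close>

section \<open>Charts and the derivatives of transition maps\<close>

lemma chart_inv_eq:
  assumes "is_chart X c" "p \<in> fst c"
  shows "chart_inv c (snd c p) = p"
proof -
  have "topspace (subtopology X (fst c)) = fst c"
    using assms(1) by (auto simp: is_chart_def dest: openin_subset)
  then have "inj_on (snd c) (fst c)"
    using assms(1) by (auto simp: is_chart_def homeomorphic_eq_everything_map)
  then show ?thesis
    using assms(2) by (simp add: chart_inv_def)
qed

text \<open>A chart is an open map onto its image, and that image is itself open, so relatively open
  images are open in the coordinate space.\<close>

lemma open_chart_image:
  assumes "is_chart X c" "openin X U" "U \<subseteq> fst c"
  shows "open (snd c ` U)"
proof -
  have "open_map (subtopology X (fst c)) (top_of_set (snd c ` fst c)) (snd c)"
    using assms(1) by (auto simp: is_chart_def homeomorphic_eq_everything_map)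
  moreover have "openin (subtopology X (fst c)) U"
    using assms by (simp add: is_chart_def openin_open_subtopology)
  ultimately have "openin (top_of_set (snd c ` fst c)) (snd c ` U)"
    by (simp add: open_map_def)
  then show ?thesis
    using assms(1) by (auto simp: is_chart_def openin_open_eq)
qed

lemma smooth_on_imp_differentiable_on: "smooth_on S f \<Longrightarrow> f differentiable_on S"
  unfolding smooth_on_def using Ck_on.simps(2)[of 0 S f] by blast

text \<open>Smoothness of a transition map is stated with derivatives within the image of the chart
  overlap. That image is open, so the ordinary derivative in \<open>transition_deriv\<close> exists
  as well.\<close>

lemma transition_has_derivative:
  assumes "smooth_manifold X A" "c \<in> charts_at A p" "d \<in> charts_at A p"
  shows "(snd d \<circ> chart_inv c has_derivative transition_deriv c d p) (at (snd c p))"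
proof -
  let ?S = "snd c ` (fst c \<inter> fst d)"
  have cd: "is_chart X c" "is_chart X d" and "smooth_on ?S (snd d \<circ> chart_inv c)"
    using assms by (auto simp: smooth_manifold_def charts_at_def)
  then have "(snd d \<circ> chart_inv c) differentiable_on ?S"
    by (blast intro: smooth_on_imp_differentiable_on)
  moreover have "open ?S"
    by (rule open_chart_image[OF cd(1)]) (use cd in \<open>auto simp: is_chart_def\<close>)
  moreover have "snd c p \<in> ?S"
    using assms by (auto simp: charts_at_def)
  ultimately have "(snd d \<circ> chart_inv c) differentiable at (snd c p)"
    using differentiable_on_eq_differentiable_at by blast
  then show ?thesis
    unfolding transition_deriv_def by (simp add: frechet_derivative_works)
qed

lemma linear_transition_deriv:
  assumes "smooth_manifold X A" "c \<in> charts_at A p" "d \<in> charts_at A p"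
  shows "linear (transition_deriv c d p)"
  using transition_has_derivative[OF assms] by (rule has_derivative_linear)

section \<open>Tangent spaces as vector spaces\<close>

lemma tangent_space_transition:
  "v \<in> tangent_space A p \<Longrightarrow> c \<in> charts_at A p \<Longrightarrow> d \<in> charts_at A p \<Longrightarrow>
    v d = transition_deriv c d p (v c)"
  unfolding tangent_space_def by blast

lemma tangent_space_outside:
  "v \<in> tangent_space A p \<Longrightarrow> c \<notin> charts_at A p \<Longrightarrow> v c = 0"
  unfolding tangent_space_def by blast

lemma tangent_space_tadd:
  assumes "smooth_manifold X A" "u \<in> tangent_space A p" "v \<in> tangent_space A p"
  shows "tadd u v \<in> tangent_space A p"
  unfolding tangent_space_def
proof (intro CollectI conjI ballI allI impI)
  fix c d assume cd: "c \<in> charts_at A p" "d \<in> charts_at A p"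
  have "u d = transition_deriv c d p (u c)" "v d = transition_deriv c d p (v c)"
    using assms cd by (blast intro: tangent_space_transition)+
  then show "tadd u v d = transition_deriv c d p (tadd u v c)"
    using linear_transition_deriv[OF assms(1) cd] by (simp add: tadd_def linear_add)
next
  fix c assume "c \<notin> charts_at A p"
  then show "tadd u v c = 0"
    using assms by (simp add: tangent_space_outside tadd_def)
qed

lemma tangent_space_tscale:
  assumes "smooth_manifold X A" "u \<in> tangent_space A p"
  shows "tscale r u \<in> tangent_space A p"
  unfolding tangent_space_def
proof (intro CollectI conjI ballI allI impI)
  fix c d assume cd: "c \<in> charts_at A p" "d \<in> charts_at A p"
  have "u d = transition_deriv c d p (u c)"
    using assms cd by (blast intro: tangent_space_transition)
  then show "tscale r u d = transition_deriv c d p (tscale r u c)"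
    using linear_transition_deriv[OF assms(1) cd] by (simp add: tscale_def linear_scale)
next
  fix c assume "c \<notin> charts_at A p"
  then show "tscale r u c = 0"
    using assms by (simp add: tangent_space_outside tscale_def)
qed

text \<open>The components in one chart around \<open>p\<close> fix those in every other via the
  transition derivatives, and the remaining values are 0 by convention. Equations between tangent
  vectors thus reduce to equations in one coordinate space.\<close>

lemma tangent_space_eqI:
  assumes "u \<in> tangent_space A p" "v \<in> tangent_space A p" "c \<in> charts_at A p" "u c = v c"
  shows "u = v"
proof
  fix d
  show "u d = v d"
  proof (cases "d \<in> charts_at A p")
    case True
    then have "u d = transition_deriv c d p (u c)" "v d = transition_deriv c d p (v c)"
      using assms by (blast intro: tangent_space_transition)+
    then show ?thesis
      using assms(4) by simp
  qed (use assms in \<open>simp add: tangent_space_outside\<close>)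
qed

section \<open>The velocity of a curve\<close>

lemma curve_has_vector_derivative:
  assumes "smooth_manifold X A" "smooth_curve X A I C" "t \<in> I" "c \<in> charts_at A (C t)"
  shows "(snd c \<circ> C has_vector_derivative velocity A I C t c) (at t within I)"
proof -
  have c: "c \<in> A" "C t \<in> fst c" "openin X (fst c)"
    using assms by (auto simp: charts_at_def smooth_manifold_def is_chart_def)
  let ?J = "{t \<in> I. C t \<in> fst c}"
  have "openin (top_of_set I) ?J"
    using assms(2) c(3) openin_continuous_map_preimage[of "top_of_set I" X C "fst c"]
    by (simp add: smooth_curve_def)
  then obtain T where T: "open T" "?J = I \<inter> T"
    by (auto simp: openin_open)
  have "(snd c \<circ> C) differentiable_on ?J"
    using assms(2) c(1) by (auto simp: smooth_curve_def intro: smooth_on_imp_differentiable_on)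
  then have "(snd c \<circ> C) differentiable (at t within ?J)"
    using assms(3) c(2) by (simp add: differentiable_on_def)
  moreover have "at t within ?J = at t within I"
    by (rule at_within_nhd[of t T]) (use assms(3) c(2) T in auto)
  ultimately have "(snd c \<circ> C) differentiable (at t within I)"
    by simp
  then show ?thesis
    using assms(4) by (simp add: velocity_def vector_derivative_works)
qed

text \<open>The transformation law is the chain rule for \<open>snd d \<circ> C\<close>, which near
  \<open>t\<close> factors as the transition map after \<open>snd c \<circ> C\<close>.\<close>

lemma velocity_in_tangent_space:
  assumes "smooth_manifold X A" "smooth_curve X A I C" "t \<in> I"
  shows "velocity A I C t \<in> tangent_space A (C t)"
  unfolding tangent_space_def
proof (intro CollectI conjI ballI allI impI)
  fix c d assume cd: "c \<in> charts_at A (C t)" "d \<in> charts_at A (C t)"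
  let ?v = "velocity A I C t" and ?L = "transition_deriv c d (C t)"
  have c: "is_chart X c" "C t \<in> fst c" "openin X (fst c)"
    using assms(1) cd by (auto simp: charts_at_def smooth_manifold_def is_chart_def)
  have "(snd c \<circ> C has_derivative (\<lambda>h. h *\<^sub>R ?v c)) (at t within I)"
    using curve_has_vector_derivative[OF assms cd(1)] by (simp add: has_vector_derivative_def)
  moreover have "(snd d \<circ> chart_inv c has_derivative ?L) (at ((snd c \<circ> C) t))"
    using transition_has_derivative[OF assms(1) cd] by simp
  ultimately have "((snd d \<circ> chart_inv c) \<circ> (snd c \<circ> C) has_derivative
      ?L \<circ> (\<lambda>h. h *\<^sub>R ?v c)) (at t within I)"
    by (rule diff_chain_within[OF _ has_derivative_at_withinI])
  moreover have "?L \<circ> (\<lambda>h. h *\<^sub>R ?v c) = (\<lambda>h. h *\<^sub>R ?L (?v c))"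
    using linear_transition_deriv[OF assms(1) cd] by (auto simp: linear_scale)
  ultimately have D: "((snd d \<circ> chart_inv c) \<circ> (snd c \<circ> C) has_vector_derivative ?L (?v c))
      (at t within I)"
    by (simp add: has_vector_derivative_def)
  \<comment> \<open>The factorization holds only while the curve stays in the domain of
    \<open>c\<close>. By continuity this is so for all parameters in \<open>I\<close> close enough
    to \<open>t\<close>.\<close>
  have "openin (top_of_set I) {t \<in> I. C t \<in> fst c}"
    using assms(2) c(3) openin_continuous_map_preimage[of "top_of_set I" X C "fst c"]
    by (simp add: smooth_curve_def)
  then obtain T where T: "open T" "{t \<in> I. C t \<in> fst c} = I \<inter> T"
    by (auto simp: openin_open)
  note \<open>open T\<close>
  moreover have "t \<in> T"
    using T(2) assms(3) c(2) by auto
  ultimately obtain e where "e > 0" and e: "ball t e \<subseteq> T"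
    by (auto simp: open_contains_ball)
  have "(snd d \<circ> C has_vector_derivative ?L (?v c)) (at t within I)"
  proof (rule has_vector_derivative_transform_within[OF D \<open>e > 0\<close> assms(3)])
    show "((snd d \<circ> chart_inv c) \<circ> (snd c \<circ> C)) s = (snd d \<circ> C) s" if "s \<in> I" "dist s t < e" for s
    proof -
      have "s \<in> I \<inter> T"
        using e that by (auto simp: dist_commute)
      then have "C s \<in> fst c"
        using T(2) by blast
      then show ?thesis
        using chart_inv_eq[OF c(1)] by simp
    qed
  qed
  moreover have "(snd d \<circ> C has_vector_derivative ?v d) (at t within I)"
    using curve_has_vector_derivative[OF assms cd(2)] .
  moreover have "at t within I \<noteq> bot"
  proof -
    \<comment> \<open>Derivatives within \<open>I\<close> are unique only at limit points of
      \<open>I\<close>; a nondegenerate interval consists of such points.\<close>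
    have "connected I" "\<nexists>x. I = {x}"
      using assms(2) by (auto simp: smooth_curve_def is_interval_connected)
    then have "t islimpt I"
      using assms(3) by (blast intro: connected_imp_perfect)
    then show ?thesis
      by (simp add: trivial_limit_within)
  qed
  ultimately show "?v d = ?L (?v c)"
    using vector_derivative_unique_within by blast
next
  fix c assume "c \<notin> charts_at A (C t)"
  then show "velocity A I C t c = 0"
    by (simp add: velocity_def)
qed

section \<open>Linear algebra in a single tangent space\<close>

text \<open>Independence makes the map from coefficients to combinations an injective endomorphism
  of \<open>real ^ 3\<close>, hence a surjective one. Dimension three enters here.\<close>

lemma independent_3_spans:
  fixes x y z w :: "real ^ 3"
  assumes indep: "\<And>\<alpha> \<beta> \<gamma>. \<alpha> *\<^sub>R x + \<beta> *\<^sub>R y + \<gamma> *\<^sub>R z = 0 \<Longrightarrow> \<alpha> = 0 \<and> \<beta> = 0 \<and> \<gamma> = 0"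
  obtains \<alpha> \<beta> \<gamma> where "w = \<alpha> *\<^sub>R x + \<beta> *\<^sub>R y + \<gamma> *\<^sub>R z"
proof -
  define f :: "real ^ 3 \<Rightarrow> real ^ 3" where "f = (\<lambda>k. k $ 1 *\<^sub>R x + k $ 2 *\<^sub>R y + k $ 3 *\<^sub>R z)"
  have lin: "linear f"
    by (rule linearI) (simp_all add: f_def scaleR_add_left scaleR_add_right)
  moreover have "inj f"
    unfolding linear_injective_0[OF lin]
  proof (intro allI impI)
    fix k assume "f k = 0"
    then have "k $ 1 = 0 \<and> k $ 2 = 0 \<and> k $ 3 = 0"
      unfolding f_def by (rule indep)
    then show "k = 0"
      by (simp add: vec_eq_iff forall_3)
  qed
  ultimately have "surj f"
    by (rule linear_injective_imp_surjective) simp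
  then obtain k where "w = f k"
    by blast
  then show thesis
    using that by (simp add: f_def)
qed

text \<open>The condition \<open>\<eta> p u = 0\<close> serves the independence of the three
  vectors, the three conditions on \<open>g\<close> the orthogonality of \<open>u\<close> to their
  span.\<close>

lemma null_slant_vector_eq_tzero:
  assumes M: "almost_contact_B_metric_3manifold X A \<phi> \<xi> \<eta> g"
    and p: "p \<in> topspace X" and u: "u \<in> tangent_space A p"
    and \<eta>u: "\<eta> p u = 0" and orth: "g p u u = 0" "g p u (\<phi> p u) = 0" "g p u (\<xi> p) = 0"
  shows "u = tzero"
proof (rule ccontr)
  assume "u \<noteq> tzero"
  let ?T = "tangent_space A p"
  have sm: "smooth_manifold X A" and "tensor_field_11 X A \<phi>" and "vector_field X A \<xi>"
    and "one_form X A \<eta>" and "semi_riemannian_metric X A g" and eta_xi: "\<eta> p (\<xi> p) = 1"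
    and phi2: "\<And>u. u \<in> ?T \<Longrightarrow> \<phi> p (\<phi> p u) = tadd (tscale (- 1) u) (tscale (\<eta> p u) (\<xi> p))"
    using M p by (simp_all add: almost_contact_B_metric_3manifold_def)
  have phi: "\<And>u. u \<in> ?T \<Longrightarrow> \<phi> p u \<in> ?T"
    and phi_add: "\<And>u v. u \<in> ?T \<Longrightarrow> v \<in> ?T \<Longrightarrow> \<phi> p (tadd u v) = tadd (\<phi> p u) (\<phi> p v)"
    and phi_scale: "\<And>r u. u \<in> ?T \<Longrightarrow> \<phi> p (tscale r u) = tscale r (\<phi> p u)"
    using \<open>tensor_field_11 X A \<phi>\<close> p unfolding tensor_field_11_def by blast+
  have xi: "\<xi> p \<in> ?T"
    using \<open>vector_field X A \<xi>\<close> p by (simp add: vector_field_def)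
  have eta_add: "\<And>u v. u \<in> ?T \<Longrightarrow> v \<in> ?T \<Longrightarrow> \<eta> p (tadd u v) = \<eta> p u + \<eta> p v"
    and eta_scale: "\<And>r u. u \<in> ?T \<Longrightarrow> \<eta> p (tscale r u) = r * \<eta> p u"
    using \<open>one_form X A \<eta>\<close> p unfolding one_form_def by blast+
  have "tensor_field_02 X A g"
    and nondeg: "\<And>u. u \<in> ?T \<Longrightarrow> \<forall>v\<in>?T. g p u v = 0 \<Longrightarrow> u = tzero"
    using \<open>semi_riemannian_metric X A g\<close> p unfolding semi_riemannian_metric_def by blast+
  then have g_add: "\<And>u v w. u \<in> ?T \<Longrightarrow> v \<in> ?T \<Longrightarrow> w \<in> ?T \<Longrightarrow> g p w (tadd u v) = g p w u + g p w v"
    and g_scale: "\<And>r u w. u \<in> ?T \<Longrightarrow> w \<in> ?T \<Longrightarrow> g p w (tscale r u) = r * g p w u"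
    using p unfolding tensor_field_02_def by blast+
  note add = tangent_space_tadd[OF sm] and scale = tangent_space_tscale[OF sm]
  have zero: "tzero \<in> ?T"
    using scale[OF u, of 0] by (simp add: tscale_def tzero_def)
  have eta_zero: "\<eta> p tzero = 0"
    using eta_scale[OF zero, of 0] by (simp add: tscale_def tzero_def)
  have phi_zero: "\<phi> p tzero = tzero"
    using phi_scale[OF zero, of 0] by (simp add: tscale_def tzero_def)
  obtain c where c: "c \<in> charts_at A p"
    using sm p unfolding smooth_manifold_def charts_at_def by blast
  have phi2u: "\<phi> p (\<phi> p u) = tscale (- 1) u"
    using phi2[OF u] \<eta>u by (simp add: tadd_def tscale_def)
  have eta_phi: "\<eta> p (\<phi> p u) = 0"
  proof -
    \<comment> \<open>The third iterate of \<open>\<phi>\<close> on \<open>u\<close> is computed in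
      two ways: by the structure identity at \<open>\<phi> p u\<close>, and as \<open>\<phi>\<close>
      applied to the negative of \<open>u\<close>.\<close>
    have "tadd (tscale (- 1) (\<phi> p u)) (tscale (\<eta> p (\<phi> p u)) (\<xi> p)) = tscale (- 1) (\<phi> p u)"
      using phi2[OF phi[OF u]] phi_scale[OF u, of "- 1"] phi2u by simp
    then have "tscale (\<eta> p (\<phi> p u)) (\<xi> p) = tzero"
      by (simp add: fun_eq_iff tadd_def tscale_def tzero_def)
    then show ?thesis
      using eta_scale[OF xi, of "\<eta> p (\<phi> p u)"] eta_xi eta_zero by simp
  qed
  let ?comb = "\<lambda>\<alpha> \<beta> \<gamma>. tadd (tadd (tscale \<alpha> u) (tscale \<beta> (\<phi> p u))) (tscale \<gamma> (\<xi> p))"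
  have comb: "?comb \<alpha> \<beta> \<gamma> \<in> ?T" for \<alpha> \<beta> \<gamma>
    by (intro add scale u phi xi)
  have indep: "\<alpha> = 0 \<and> \<beta> = 0 \<and> \<gamma> = 0"
    if "\<alpha> *\<^sub>R u c + \<beta> *\<^sub>R \<phi> p u c + \<gamma> *\<^sub>R \<xi> p c = 0" for \<alpha> \<beta> \<gamma>
  proof -
    \<comment> \<open>The relation in the chart \<open>c\<close> is lifted to tangent vectors, on
      which \<open>\<eta>\<close> and \<open>\<phi>\<close> can act. Applying \<open>\<eta>\<close>
      isolates \<open>\<gamma>\<close>; applying \<open>\<phi>\<close> to what is left gives a
      second relation between \<open>u\<close> and \<open>\<phi> p u\<close>.\<close>
    have eq: "?comb \<alpha> \<beta> \<gamma> = tzero"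
      by (rule tangent_space_eqI[OF comb zero c]) (use that in \<open>simp add: tadd_def tscale_def tzero_def\<close>)
    have "\<eta> p (?comb \<alpha> \<beta> \<gamma>) = \<gamma>"
      by (simp add: eta_add eta_scale add scale u phi xi \<eta>u eta_phi eta_xi)
    then have \<gamma>: "\<gamma> = 0"
      using eq eta_zero by simp
    have eq1: "tadd (tscale \<alpha> u) (tscale \<beta> (\<phi> p u)) = tzero"
      using eq \<gamma> by (simp add: tadd_def tscale_def tzero_def)
    then have "tadd (tscale \<alpha> (\<phi> p u)) (tscale \<beta> (tscale (- 1) u)) = tzero"
      using phi_add[OF scale[OF u, of \<alpha>] scale[OF phi[OF u], of \<beta>]]
      by (simp add: phi_scale u phi phi2u phi_zero)
    then have e2: "\<alpha> *\<^sub>R \<phi> p u c' = \<beta> *\<^sub>R u c'" for c'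
      by (auto simp: tadd_def tscale_def tzero_def dest: fun_cong[where x = c'])
    have e1: "\<alpha> *\<^sub>R u c' + \<beta> *\<^sub>R \<phi> p u c' = 0" for c'
      using fun_cong[OF eq1, of c'] by (simp add: tadd_def tscale_def tzero_def)
    \<comment> \<open>The two relations eliminate \<open>\<phi> p u\<close>, as in multiplying a
      complex number by its conjugate. Since \<open>u\<close> is nonzero in some chart, the sum of
      squares vanishes.\<close>
    have "(\<alpha>\<^sup>2 + \<beta>\<^sup>2) *\<^sub>R u c' = 0" for c'
    proof -
      have "(\<alpha>\<^sup>2 + \<beta>\<^sup>2) *\<^sub>R u c' = \<alpha> *\<^sub>R (\<alpha> *\<^sub>R u c') + \<beta> *\<^sub>R (\<beta> *\<^sub>R u c')"
        by (simp add: power2_eq_square scaleR_add_left)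
      also have "\<dots> = \<alpha> *\<^sub>R (\<alpha> *\<^sub>R u c' + \<beta> *\<^sub>R \<phi> p u c')"
        by (simp add: e2[symmetric] scaleR_add_right mult.commute)
      finally show ?thesis
        by (simp add: e1)
    qed
    then have "\<alpha>\<^sup>2 + \<beta>\<^sup>2 = 0"
      using \<open>u \<noteq> tzero\<close> unfolding tzero_def by (metis ext scaleR_eq_0_iff)
    then show ?thesis
      using \<gamma> by (simp add: sum_power2_eq_zero_iff)
  qed
  have "g p u v = 0" if v: "v \<in> ?T" for v
  proof -
    obtain \<alpha> \<beta> \<gamma> where "v c = \<alpha> *\<^sub>R u c + \<beta> *\<^sub>R \<phi> p u c + \<gamma> *\<^sub>R \<xi> p c"
      using independent_3_spans[OF indep] by blast
    then have "v = ?comb \<alpha> \<beta> \<gamma>"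
      by (intro tangent_space_eqI[OF v comb c]) (simp add: tadd_def tscale_def)
    then show ?thesis
      by (simp add: g_add g_scale add scale u phi xi orth)
  qed
  then show False
    using nondeg[OF u] \<open>u \<noteq> tzero\<close> by blast
qed

theorem proposition3p3:
  fixes X :: "'a topology"
    and A :: "('a, real ^ 3) chart set"
    and \<phi> :: "'a \<Rightarrow> ('a, real ^ 3) tvec \<Rightarrow> ('a, real ^ 3) tvec"
    and \<xi> :: "'a \<Rightarrow> ('a, real ^ 3) tvec"
    and \<eta> :: "'a \<Rightarrow> ('a, real ^ 3) tvec \<Rightarrow> real"
    and g :: "'a \<Rightarrow> ('a, real ^ 3) tvec \<Rightarrow> ('a, real ^ 3) tvec \<Rightarrow> real"
  assumes "almost_contact_B_metric_3manifold X A \<phi> \<xi> \<eta> g"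
  shows "\<not> (\<exists>I C a b. null_curve X A g I C \<and> phi_slant A \<phi> \<xi> \<eta> g I C a b \<and> a = 0 \<and> b = 0)"
proof
  assume "\<exists>I C a b. null_curve X A g I C \<and> phi_slant A \<phi> \<xi> \<eta> g I C a b \<and> a = 0 \<and> b = 0"
  then obtain I C where null: "null_curve X A g I C" and slant: "phi_slant A \<phi> \<xi> \<eta> g I C 0 0"
    by blast
  have curve: "smooth_curve X A I C"
    using null by (simp add: null_curve_def)
  \<comment> \<open>One parameter value suffices, as the contradiction is pointwise.\<close>
  then obtain t where t: "t \<in> I"
    by (auto simp: smooth_curve_def)
  have "C t \<in> topspace X"
    using curve t by (auto simp: smooth_curve_def continuous_map_def)
  moreover have "velocity A I C t \<in> tangent_space A (C t)"
    using assms curve t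
    by (auto simp: almost_contact_B_metric_3manifold_def intro: velocity_in_tangent_space)
  ultimately have "velocity A I C t = tzero"
    using null slant t
    by (intro null_slant_vector_eq_tzero[OF assms]) (auto simp: null_curve_def phi_slant_def)
  then show False
    using null t by (simp add: null_curve_def)
qed

end
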